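(* Let $n=k^2$, where $k$ is an integer with $k\ge 2$. Consider the equation $$x^4+y^4+z^4-2x^2y^2-2y^2z^2-2z^2x^2=n ,$$ and let $S$ be the set of all integer solutions $(a,b,c)$ of this equation with exactly one of $a,b,c$ being zero. (i) If $k\equiv 2\pmod 4$, then $S=\emptyset$. (ii) If $k\equiv 0,1$ or $3\pmod 4$, then $S$ is a finite nonempty set which can be described as follows. For each pair $(d_1,d_2)$ of positive divisors of $k$ such that $d_1\equiv d_2\pmod 2$, $1\le d_2<d_1$ and $d_1d_2=k$, define the positive integers $e=\frac{d_1+d_2}{2}$ and $f=\frac{d_1-d_2}{2}$. Each such pair $(d_1,d_2)$ yields exactly twenty-four distinct elements of $S$: $$(\pm e,\pm f,0),\ (\pm e,0,\pm f),\ (\pm f,\pm e,0),\ (\pm f,0,\pm e),\ (0,\pm e,\pm f),\ (0,\pm f,\pm e),$$ with all sign combinations; $S$ is the union of these sets of twenty-four triples over all such pairs $(d_1,d_2)$; and the number of elements of $S$ is $24N$, where $N$ is the number of pairs $(d_1,d_2)$ of positive integers satisfying $d_1\equiv d_2\pmod 2$, $1\le d_2<d_1$ and $d_1d_2=k$.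
   Formalization: In (ii), S is claimed nonempty only for k ≠ 4: for k = 4 the only factorization of equal parity is 2·2, which is not allowed, so N = 0 and S is empty; all other claims are kept for k = 4. *)

theory Defs
  imports "HOL-Number_Theory.Cong"
begin

definition heron_solutions :: "int \<Rightarrow> (int \<times> int \<times> int) set" where
  "heron_solutions n =
     {(x, y, z). x^4 + y^4 + z^4 - 2 * x^2 * y^2 - 2 * y^2 * z^2 - 2 * z^2 * x^2 = n}"

definition one_zero_solutions :: "int \<Rightarrow> (int \<times> int \<times> int) set" where
  "one_zero_solutions n =
     {(a, b, c). (a, b, c) \<in> heron_solutions n \<and>
        (a = 0 \<and> b \<noteq> 0 \<and> c \<noteq> 0 \<or>
         a \<noteq> 0 \<and> b = 0 \<and> c \<noteq> 0 \<or>
         a \<noteq> 0 \<and> b \<noteq> 0 \<and> c = 0)}"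

text \<open>The condition \<open>d1 * d2 = k\<close> already makes both components divisors of \<open>k\<close>.\<close>

definition factor_pairs :: "int \<Rightarrow> (int \<times> int) set" where
  "factor_pairs k =
     {(d1, d2). 1 \<le> d2 \<and> d2 < d1 \<and> [d1 = d2] (mod 2) \<and> d1 * d2 = k}"

text \<open>On \<open>factor_pairs k\<close> the components have equal parity, so both divisions by 2 are exact.\<close>

definition half_sum :: "int \<Rightarrow> int \<Rightarrow> int" where
  "half_sum d1 d2 = (d1 + d2) div 2"

definition half_diff :: "int \<Rightarrow> int \<Rightarrow> int" where
  "half_diff d1 d2 = (d1 - d2) div 2"

definition signed_triples :: "int \<Rightarrow> int \<Rightarrow> (int \<times> int \<times> int) set" where
  "signed_triples e f =
     (\<Union>s\<in>{1, -1}. \<Union>t\<in>{1, -1}.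
        {(s * e, t * f, 0), (s * e, 0, t * f),
         (s * f, t * e, 0), (s * f, 0, t * e),
         (0, s * e, t * f), (0, s * f, t * e)})"

end

theory Submission
  imports Defs
begin

text \<open>
  If one coordinate vanishes, the quartic form is a perfect square: for the remaining coordinates
  \<open>x\<close>, \<open>y\<close> it equals \<open>(x\<^sup>2 - y\<^sup>2)\<^sup>2\<close>. Hence for \<open>n = k\<^sup>2\<close> the larger of \<open>\<bar>x\<bar>\<close>, \<open>\<bar>y\<bar>\<close>, say
  \<open>e\<close>, and the smaller one, \<open>f\<close>, satisfy \<open>(e + f) * (e - f) = k\<close>, and \<open>d1 = e + f\<close>, \<open>d2 = e - f\<close>
  is a factorization of \<open>k\<close> into distinct factors of equal parity. Conversely such a factorization
  returns \<open>e\<close> and \<open>f\<close> as half sum and half difference. This is \<open>square_difference_iff\<close>; the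
  placement of the zero, the order of \<open>e\<close>, \<open>f\<close> and their signs give the twenty-four triples
  (\<open>mem_signed_triples_iff\<close>, \<open>card_signed_triples\<close>).

  The factorization can be read off any of its triples, because \<open>d1\<close> is the sum of the absolute
  values of the coordinates. So the sets of triples are pairwise disjoint and their cardinalities
  add up. Finally, a product of two integers of equal parity is odd or divisible by \<open>4\<close>, which
  excludes \<open>k \<equiv> 2 (mod 4)\<close>; in the other cases \<open>(k, 1)\<close> or \<open>(k/2, 2)\<close> is a factorization of the
  required kind, unless \<open>k = 4\<close>, where \<open>(2, 2)\<close> has equal factors.
\<close>

section \<open>Factorizations into distinct factors of equal parity\<close>

lemma factor_pairs_iff:
  "(d1, d2) \<in> factor_pairs k \<longleftrightarrow> 1 \<le> d2 \<and> d2 < d1 \<and> even (d1 - d2) \<and> d1 * d2 = k"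
  by (auto simp: factor_pairs_def cong_iff_dvd_diff)

lemma half_sum_double: "even (d1 - d2) \<Longrightarrow> 2 * half_sum d1 d2 = d1 + d2"
  unfolding half_sum_def by presburger

lemma half_diff_double: "even (d1 - d2) \<Longrightarrow> 2 * half_diff d1 d2 = d1 - d2"
  unfolding half_diff_def by presburger

lemma half_bounds:
  assumes "(d1, d2) \<in> factor_pairs k"
  shows "0 < half_diff d1 d2" "half_diff d1 d2 < half_sum d1 d2"
  using assms half_sum_double[of d1 d2] half_diff_double[of d1 d2]
  by (auto simp: factor_pairs_iff)

lemma half_sum_plus_half_diff:
  assumes "(d1, d2) \<in> factor_pairs k"
  shows "half_sum d1 d2 + half_diff d1 d2 = d1"
  using assms half_sum_double[of d1 d2] half_diff_double[of d1 d2]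
  by (auto simp: factor_pairs_iff)

lemma finite_factor_pairs: "finite (factor_pairs k)"
proof (rule finite_subset)
  show "factor_pairs k \<subseteq> {1..k} \<times> {1..k}"
  proof safe
    fix d1 d2 assume "(d1, d2) \<in> factor_pairs k"
    then have d: "1 \<le> d2" "d2 < d1" "d1 * d2 = k"
      by (auto simp: factor_pairs_iff)
    moreover have "d1 * 1 \<le> d1 * d2"
      using d by (intro mult_left_mono) auto
    ultimately show "d1 \<in> {1..k}" "d2 \<in> {1..k}"
      by auto
  qed
qed auto

text \<open>
  If \<open>k\<close> is even, two factors of equal parity must both be even, which forces \<open>4 dvd k\<close>.
\<close>

lemma factor_pairs_empty:
  assumes "[k = 2] (mod 4)"
  shows "factor_pairs k = {}"
proof -
  have False if "(d1, d2) \<in> factor_pairs k" for d1 d2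
  proof -
    have par: "even (d1 - d2)" and k: "d1 * d2 = k"
      using that by (auto simp: factor_pairs_iff)
    have k2: "k mod 4 = 2"
      using assms by (simp add: cong_def)
    then have "even k"
      by presburger
    with par k have "even d1" "even d2"
      by auto
    then have "2 * 2 dvd d1 * d2"
      by (rule mult_dvd_mono)
    with k k2 show False
      by auto
  qed
  then show ?thesis
    by auto
qed

lemma factor_pairs_nonempty:
  assumes "k \<ge> 2" "\<not> [k = 2] (mod 4)" "k \<noteq> 4"
  shows "factor_pairs k \<noteq> {}"
proof (cases "even k")
  case False
  then have "(k, 1) \<in> factor_pairs k"
    using assms by (auto simp: factor_pairs_iff)
  then show ?thesis by blast
next
  case True
  moreover have "k mod 4 \<noteq> 2"
    using assms(2) by (simp add: cong_def)
  ultimately have "4 dvd k"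
    by presburger
  then obtain m where "k = 4 * m" ..
  then have "(2 * m, 2) \<in> factor_pairs k"
    using assms by (auto simp: factor_pairs_iff)
  then show ?thesis by blast
qed

section \<open>The twenty-four signed triples\<close>

text \<open>
  The union over the signs \<open>s\<close>, \<open>t\<close> is the full sign orbit of six basic triples, so membership
  depends on absolute values only.
\<close>

lemma mem_signed_triples_iff:
  assumes "0 \<le> e" "0 \<le> f"
  shows "(x, y, z) \<in> signed_triples e f \<longleftrightarrow>
    (\<bar>x\<bar>, \<bar>y\<bar>, \<bar>z\<bar>) \<in> {(e, f, 0), (e, 0, f), (f, e, 0), (f, 0, e), (0, e, f), (0, f, e)}"
proof -
  have abs_eq: "\<bar>w\<bar> = c \<longleftrightarrow> (\<exists>s\<in>{1, - 1}. w = s * c)" if "0 \<le> c" for w c :: int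
    using that by auto
  have orbit:
    "(\<exists>s\<in>{1, - 1}. \<exists>t\<in>{1, - 1}. x = s * u \<and> y = t * v \<and> z = 0) \<longleftrightarrow> \<bar>x\<bar> = u \<and> \<bar>y\<bar> = v \<and> \<bar>z\<bar> = 0"
    "(\<exists>s\<in>{1, - 1}. \<exists>t\<in>{1, - 1}. x = s * u \<and> y = 0 \<and> z = t * v) \<longleftrightarrow> \<bar>x\<bar> = u \<and> \<bar>y\<bar> = 0 \<and> \<bar>z\<bar> = v"
    "(\<exists>s\<in>{1, - 1}. \<exists>t\<in>{1, - 1}. x = 0 \<and> y = s * u \<and> z = t * v) \<longleftrightarrow> \<bar>x\<bar> = 0 \<and> \<bar>y\<bar> = u \<and> \<bar>z\<bar> = v"
    if "0 \<le> u" "0 \<le> v" for u v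
    unfolding abs_eq[OF that(1)] abs_eq[OF that(2)] abs_eq_0_iff by blast+
  show ?thesis
    by (simp only: signed_triples_def UN_iff insert_iff[of "(_, _)"] empty_iff prod.inject simp_thms
        bex_disj_distrib orbit[OF assms] orbit[OF assms(2,1)])
qed

lemma finite_signed_triples: "finite (signed_triples e f)"
  by (simp add: signed_triples_def)

lemma card_signed_triples:
  assumes "0 < f" "f < e"
  shows "card (signed_triples e f) = 24"
proof -
  \<comment> \<open>These are all the coincidences that could identify two of the listed triples.\<close>
  have "e \<noteq> 0" "f \<noteq> 0" "e \<noteq> f" "f \<noteq> e" "e \<noteq> - f" "f \<noteq> - e" "- e \<noteq> f" "- f \<noteq> e"
    using assms by auto
  then show ?thesis
    by (simp add: signed_triples_def card_insert_if)
qed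

section \<open>Solutions with exactly one zero coordinate\<close>

text \<open>
  The passage between positive solutions of \<open>x\<^sup>2 - y\<^sup>2 = \<plusminus> k\<close> and factorizations of \<open>k\<close>: the two
  signs correspond to the two orders of the half sum and the half difference.
\<close>

lemma square_difference_iff:
  fixes x y k :: int
  assumes "0 < k" "0 < x" "0 < y"
  shows "(x\<^sup>2 - y\<^sup>2)\<^sup>2 = k\<^sup>2 \<longleftrightarrow> (\<exists>(d1, d2) \<in> factor_pairs k.
    (x = half_sum d1 d2 \<and> y = half_diff d1 d2) \<or> (x = half_diff d1 d2 \<and> y = half_sum d1 d2))"
proof -
  have diff_iff: "u\<^sup>2 - v\<^sup>2 = k \<longleftrightarrow>
      (\<exists>(d1, d2) \<in> factor_pairs k. u = half_sum d1 d2 \<and> v = half_diff d1 d2)"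
    if pos: "0 < u" "0 < v" for u v
  proof
    assume "u\<^sup>2 - v\<^sup>2 = k"
    then have prod: "(u + v) * (u - v) = k"
      by (simp add: power2_eq_square algebra_simps)
    then have "0 < u - v"
      using pos assms(1) by (metis add_pos_pos zero_less_mult_pos)
    with pos prod have "(u + v, u - v) \<in> factor_pairs k"
      by (simp add: factor_pairs_iff)
    moreover have "u = half_sum (u + v) (u - v)" "v = half_diff (u + v) (u - v)"
      by (auto simp: half_sum_def half_diff_def)
    ultimately show "\<exists>(d1, d2) \<in> factor_pairs k. u = half_sum d1 d2 \<and> v = half_diff d1 d2"
      by blast
  next
    assume "\<exists>(d1, d2) \<in> factor_pairs k. u = half_sum d1 d2 \<and> v = half_diff d1 d2"
    then obtain d1 d2 where d: "(d1, d2) \<in> factor_pairs k"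
      and uv: "u = half_sum d1 d2" "v = half_diff d1 d2"
      by blast
    from d have "even (d1 - d2)" and k: "d1 * d2 = k"
      by (auto simp: factor_pairs_iff)
    then have "2 * u = d1 + d2" "2 * v = d1 - d2"
      using half_sum_double half_diff_double uv by auto
    then have "d1 = u + v" "d2 = u - v"
      by auto
    with k show "u\<^sup>2 - v\<^sup>2 = k"
      by (simp add: power2_eq_square algebra_simps)
  qed
  have "(x\<^sup>2 - y\<^sup>2)\<^sup>2 = k\<^sup>2 \<longleftrightarrow> x\<^sup>2 - y\<^sup>2 = k \<or> y\<^sup>2 - x\<^sup>2 = k"
    by (auto simp: power2_eq_iff)
  also have "\<dots> \<longleftrightarrow> (\<exists>(d1, d2) \<in> factor_pairs k.
    (x = half_sum d1 d2 \<and> y = half_diff d1 d2) \<or> (x = half_diff d1 d2 \<and> y = half_sum d1 d2))"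
    using diff_iff[of x y] diff_iff[of y x] assms by blast
  finally show ?thesis .
qed

lemma heron_solutions_zero:
  "(x, y, 0) \<in> heron_solutions n \<longleftrightarrow> (x\<^sup>2 - y\<^sup>2)\<^sup>2 = n"
  "(x, 0, y) \<in> heron_solutions n \<longleftrightarrow> (x\<^sup>2 - y\<^sup>2)\<^sup>2 = n"
  "(0, x, y) \<in> heron_solutions n \<longleftrightarrow> (x\<^sup>2 - y\<^sup>2)\<^sup>2 = n"
proof -
  have "x^4 + y^4 - 2 * x^2 * y^2 = (x\<^sup>2 - y\<^sup>2)\<^sup>2" "x^4 + y^4 - 2 * y^2 * x^2 = (x\<^sup>2 - y\<^sup>2)\<^sup>2"
    by algebra+
  then show
    "(x, y, 0) \<in> heron_solutions n \<longleftrightarrow> (x\<^sup>2 - y\<^sup>2)\<^sup>2 = n"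
    "(x, 0, y) \<in> heron_solutions n \<longleftrightarrow> (x\<^sup>2 - y\<^sup>2)\<^sup>2 = n"
    "(0, x, y) \<in> heron_solutions n \<longleftrightarrow> (x\<^sup>2 - y\<^sup>2)\<^sup>2 = n"
    by (simp_all add: heron_solutions_def)
qed

lemma signed_triples_zero_iff:
  assumes "0 < e" "0 < f"
  shows "(x, y, 0) \<in> signed_triples e f \<longleftrightarrow> (\<bar>x\<bar> = e \<and> \<bar>y\<bar> = f) \<or> (\<bar>x\<bar> = f \<and> \<bar>y\<bar> = e)"
    and "(x, 0, y) \<in> signed_triples e f \<longleftrightarrow> (\<bar>x\<bar> = e \<and> \<bar>y\<bar> = f) \<or> (\<bar>x\<bar> = f \<and> \<bar>y\<bar> = e)"
    and "(0, x, y) \<in> signed_triples e f \<longleftrightarrow> (\<bar>x\<bar> = e \<and> \<bar>y\<bar> = f) \<or> (\<bar>x\<bar> = f \<and> \<bar>y\<bar> = e)"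
proof -
  let ?B = "{(e, f, 0), (e, 0, f), (f, e, 0), (f, 0, e), (0, e, f), (0, f, e)}"
  have nonneg: "0 \<le> e" "0 \<le> f" and "e \<noteq> 0" "f \<noteq> 0"
    using assms by simp_all
  \<comment> \<open>For variables in place of the absolute values, since case splits on the latter explode.\<close>
  then have basic:
    "(p, q, 0) \<in> ?B \<longleftrightarrow> (p = e \<and> q = f) \<or> (p = f \<and> q = e)"
    "(p, 0, q) \<in> ?B \<longleftrightarrow> (p = e \<and> q = f) \<or> (p = f \<and> q = e)"
    "(0, p, q) \<in> ?B \<longleftrightarrow> (p = e \<and> q = f) \<or> (p = f \<and> q = e)" for p q
    by auto
  show
    "(x, y, 0) \<in> signed_triples e f \<longleftrightarrow> (\<bar>x\<bar> = e \<and> \<bar>y\<bar> = f) \<or> (\<bar>x\<bar> = f \<and> \<bar>y\<bar> = e)"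
    "(x, 0, y) \<in> signed_triples e f \<longleftrightarrow> (\<bar>x\<bar> = e \<and> \<bar>y\<bar> = f) \<or> (\<bar>x\<bar> = f \<and> \<bar>y\<bar> = e)"
    "(0, x, y) \<in> signed_triples e f \<longleftrightarrow> (\<bar>x\<bar> = e \<and> \<bar>y\<bar> = f) \<or> (\<bar>x\<bar> = f \<and> \<bar>y\<bar> = e)"
    by (simp_all only: mem_signed_triples_iff[OF nonneg] abs_zero basic)
qed

lemma signed_triples_one_zero:
  assumes "0 < e" "0 < f" "(a, b, c) \<in> signed_triples e f"
  shows "a = 0 \<and> b \<noteq> 0 \<and> c \<noteq> 0 \<or> a \<noteq> 0 \<and> b = 0 \<and> c \<noteq> 0 \<or> a \<noteq> 0 \<and> b \<noteq> 0 \<and> c = 0"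
proof -
  have "0 \<le> e" "0 \<le> f"
    using assms by simp_all
  from assms(3)[unfolded mem_signed_triples_iff[OF this] insert_iff prod.inject empty_iff]
  show ?thesis
    using assms(1,2) by (elim disjE conjE) auto
qed

text \<open>
  Wherever the zero stands, the equation for the other two coordinates is \<open>(x\<^sup>2 - y\<^sup>2)\<^sup>2 = k\<^sup>2\<close>, so
  \<open>square_difference_iff\<close> applied to their absolute values settles all three placements.
\<close>

lemma one_zero_solutions_eq:
  assumes "0 < k"
  shows "one_zero_solutions (k\<^sup>2) =
    (\<Union>(d1, d2) \<in> factor_pairs k. signed_triples (half_sum d1 d2) (half_diff d1 d2))"
    (is "_ = ?U")
proof (rule set_eqI)
  have pos: "0 < half_sum d1 d2" "0 < half_diff d1 d2" if "(d1, d2) \<in> factor_pairs k" for d1 d2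
    using half_bounds[OF that] by simp_all
  have mem_U: "t \<in> ?U \<longleftrightarrow>
      (\<exists>(d1, d2) \<in> factor_pairs k. t \<in> signed_triples (half_sum d1 d2) (half_diff d1 d2))" for t
    by auto
  have sq: "(x\<^sup>2 - y\<^sup>2)\<^sup>2 = k\<^sup>2 \<longleftrightarrow> (\<exists>(d1, d2) \<in> factor_pairs k.
      (\<bar>x\<bar> = half_sum d1 d2 \<and> \<bar>y\<bar> = half_diff d1 d2) \<or>
      (\<bar>x\<bar> = half_diff d1 d2 \<and> \<bar>y\<bar> = half_sum d1 d2))"
    if "x \<noteq> 0" "y \<noteq> 0" for x y
    using square_difference_iff[of k "\<bar>x\<bar>" "\<bar>y\<bar>"] that assms by simp
  have zero_iff:
    "(x, y, 0) \<in> heron_solutions (k\<^sup>2) \<longleftrightarrow> (x, y, 0) \<in> ?U"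
    "(x, 0, y) \<in> heron_solutions (k\<^sup>2) \<longleftrightarrow> (x, 0, y) \<in> ?U"
    "(0, x, y) \<in> heron_solutions (k\<^sup>2) \<longleftrightarrow> (0, x, y) \<in> ?U"
    if "x \<noteq> 0" "y \<noteq> 0" for x y
    unfolding mem_U heron_solutions_zero sq[OF that]
    by (intro bex_cong refl, clarify, simp only: signed_triples_zero_iff[OF pos])+
  fix t :: "int \<times> int \<times> int"
  obtain a b c where t: "t = (a, b, c)"
    by (rule prod_cases3)
  let ?Z = "a = 0 \<and> b \<noteq> 0 \<and> c \<noteq> 0 \<or> a \<noteq> 0 \<and> b = 0 \<and> c \<noteq> 0 \<or> a \<noteq> 0 \<and> b \<noteq> 0 \<and> c = 0"
  have "t \<in> one_zero_solutions (k\<^sup>2) \<longleftrightarrow> t \<in> heron_solutions (k\<^sup>2) \<and> ?Z"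
    by (simp add: one_zero_solutions_def t)
  moreover have "t \<in> heron_solutions (k\<^sup>2) \<longleftrightarrow> t \<in> ?U" if ?Z
    using that unfolding t by (elim disjE conjE) (simp_all only: zero_iff simp_thms)
  moreover have ?Z if U: "t \<in> ?U"
  proof -
    obtain d1 d2 where d: "(d1, d2) \<in> factor_pairs k"
      and "(a, b, c) \<in> signed_triples (half_sum d1 d2) (half_diff d1 d2)"
      using U[unfolded mem_U t] by blast
    then show ?thesis
      by (intro signed_triples_one_zero[OF pos[OF d]])
  qed
  ultimately show "t \<in> one_zero_solutions (k\<^sup>2) \<longleftrightarrow> t \<in> ?U"
    by argo
qed

section \<open>Counting the solutions\<close>

text \<open>
  The absolute values are the half sum, the half difference and \<open>0\<close> in some order, and half sum
  and half difference add up to the larger factor.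
\<close>

lemma signed_triples_abs_sum:
  assumes "(d1, d2) \<in> factor_pairs k"
    and "(x, y, z) \<in> signed_triples (half_sum d1 d2) (half_diff d1 d2)"
  shows "\<bar>x\<bar> + \<bar>y\<bar> + \<bar>z\<bar> = d1"
proof -
  let ?e = "half_sum d1 d2" and ?f = "half_diff d1 d2"
  have "0 \<le> ?e" "0 \<le> ?f"
    using half_bounds[OF assms(1)] by simp_all
  from assms(2)[unfolded mem_signed_triples_iff[OF this]]
  have "\<bar>x\<bar> + \<bar>y\<bar> + \<bar>z\<bar> = ?e + ?f"
    unfolding insert_iff prod.inject empty_iff by (elim disjE conjE) simp_all
  with half_sum_plus_half_diff[OF assms(1)] show ?thesis
    by simp
qed

text \<open>
  Since \<open>d2 = k / d1\<close>, recovering \<open>d1\<close> from a triple recovers the whole factorization.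
\<close>

lemma signed_triples_disjoint:
  assumes p: "(d1, d2) \<in> factor_pairs k" and q: "(d1', d2') \<in> factor_pairs k"
    and "(d1, d2) \<noteq> (d1', d2')"
  shows "signed_triples (half_sum d1 d2) (half_diff d1 d2) \<inter>
    signed_triples (half_sum d1' d2') (half_diff d1' d2') = {}"
proof -
  have "d1 \<noteq> d1'"
    using assms by (auto simp: factor_pairs_iff)
  then show ?thesis
    using signed_triples_abs_sum[OF p] signed_triples_abs_sum[OF q]
    by (metis disjoint_iff prod_cases3)
qed

lemma card_one_zero_solutions:
  assumes "0 < k"
  shows "card (one_zero_solutions (k\<^sup>2)) = 24 * card (factor_pairs k)"
proof -
  let ?T = "\<lambda>(d1, d2). signed_triples (half_sum d1 d2) (half_diff d1 d2)"
  have "card (\<Union>(?T ` factor_pairs k)) = (\<Sum>p\<in>factor_pairs k. card (?T p))"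
  proof (rule card_UN_disjoint[OF finite_factor_pairs])
    show "\<forall>p\<in>factor_pairs k. finite (?T p)"
      by (auto simp: finite_signed_triples)
    show "\<forall>p\<in>factor_pairs k. \<forall>q\<in>factor_pairs k. p \<noteq> q \<longrightarrow> ?T p \<inter> ?T q = {}"
      using signed_triples_disjoint by (fastforce simp del: disjoint_iff)
  qed
  also have "\<dots> = (\<Sum>p\<in>factor_pairs k. 24)"
    by (rule sum.cong) (auto intro!: card_signed_triples half_bounds)
  finally show ?thesis
    using one_zero_solutions_eq[OF assms] by simp
qed

theorem theorem8:
  fixes n k :: int
  assumes "k \<ge> 2" and "n = k^2"
  shows "([k = 2] (mod 4) \<longrightarrow> one_zero_solutions n = {}) \<and>
    ([k = 0] (mod 4) \<or> [k = 1] (mod 4) \<or> [k = 3] (mod 4) \<longrightarrow>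
       finite (one_zero_solutions n) \<and>
       (k \<noteq> 4 \<longrightarrow> one_zero_solutions n \<noteq> {}) \<and>
       (\<forall>(d1, d2) \<in> factor_pairs k.
          2 * half_sum d1 d2 = d1 + d2 \<and> half_sum d1 d2 > 0 \<and>
          2 * half_diff d1 d2 = d1 - d2 \<and> half_diff d1 d2 > 0 \<and>
          signed_triples (half_sum d1 d2) (half_diff d1 d2) \<subseteq> one_zero_solutions n \<and>
          card (signed_triples (half_sum d1 d2) (half_diff d1 d2)) = 24) \<and>
       one_zero_solutions n =
         (\<Union>(d1, d2) \<in> factor_pairs k.
            signed_triples (half_sum d1 d2) (half_diff d1 d2)) \<and>
       card (one_zero_solutions n) = 24 * card (factor_pairs k))"
proof -
  have k: "0 < k"
    using assms(1) by simp
  note S = one_zero_solutions_eq[OF k, folded assms(2)]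
  have empty: "one_zero_solutions n = {}" if "[k = 2] (mod 4)"
    using S factor_pairs_empty[OF that] by simp
  have nonempty: "one_zero_solutions n \<noteq> {}"
    if k_mod: "[k = 0] (mod 4) \<or> [k = 1] (mod 4) \<or> [k = 3] (mod 4)" and k4: "k \<noteq> 4"
  proof -
    have "\<not> [k = 2] (mod 4)"
      using k_mod by (auto simp: cong_def)
    then obtain d1 d2 where d: "(d1, d2) \<in> factor_pairs k"
      using factor_pairs_nonempty[OF assms(1) _ k4] by fast
    then have "card (signed_triples (half_sum d1 d2) (half_diff d1 d2)) = 24"
      by (intro card_signed_triples half_bounds)
    then have "signed_triples (half_sum d1 d2) (half_diff d1 d2) \<noteq> {}"
      by (metis card.empty zero_neq_numeral)
    moreover have "signed_triples (half_sum d1 d2) (half_diff d1 d2) \<subseteq> one_zero_solutions n"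
      unfolding S using d by blast
    ultimately show ?thesis
      by blast
  qed
  have fin: "finite (one_zero_solutions n)"
    unfolding S using finite_factor_pairs by (auto simp: finite_signed_triples)
  have pairs: "\<forall>(d1, d2) \<in> factor_pairs k.
      2 * half_sum d1 d2 = d1 + d2 \<and> half_sum d1 d2 > 0 \<and>
      2 * half_diff d1 d2 = d1 - d2 \<and> half_diff d1 d2 > 0 \<and>
      signed_triples (half_sum d1 d2) (half_diff d1 d2) \<subseteq> one_zero_solutions n \<and>
      card (signed_triples (half_sum d1 d2) (half_diff d1 d2)) = 24"
  proof clarify
    fix d1 d2 assume d: "(d1, d2) \<in> factor_pairs k"
    note b = half_bounds[OF d]
    have "even (d1 - d2)"
      using d by (simp add: factor_pairs_iff)
    moreover have "signed_triples (half_sum d1 d2) (half_diff d1 d2) \<subseteq> one_zero_solutions n"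
      unfolding S using d by blast
    ultimately show "2 * half_sum d1 d2 = d1 + d2 \<and> half_sum d1 d2 > 0 \<and>
      2 * half_diff d1 d2 = d1 - d2 \<and> half_diff d1 d2 > 0 \<and>
      signed_triples (half_sum d1 d2) (half_diff d1 d2) \<subseteq> one_zero_solutions n \<and>
      card (signed_triples (half_sum d1 d2) (half_diff d1 d2)) = 24"
      using b card_signed_triples[OF b] half_sum_double half_diff_double by simp
  qed
  have card: "card (one_zero_solutions n) = 24 * card (factor_pairs k)"
    using card_one_zero_solutions[OF k] assms(2) by simp
  show ?thesis
    by (intro conjI impI empty nonempty fin pairs S card; assumption)
qed

end
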